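(* Let $(O_1)$ and $(O_2)$ be the internal circles of an arbelos, with radii $R_1,R_2>0$, and let $s_1,s_2$ be the radii of the two twin-cousins of the associated doubling arbelos. Then $$\frac1{s_1}+\frac1{s_2}=3\left[\frac1{R_1}+\frac1{R_2}\right].$$
   Context: Arbelos: $(O_1)$ and $(O_2)$ are circles with centers $O_1,O_2$ and radii $R_1,R_2>0$, externally tangent at the point $M$. The external circle $(O)$ has center $O$ on the line $O_1O_2$ and radius $R_1+R_2$, and is internally tangent to $(O_1)$ at $A_1$ and to $(O_2)$ at $A_2$, so that $A_1,O_1,M,O_2,A_2$ lie on one line in this order and $[A_1A_2]$ is a diameter of $(O)$. Doubling arbelos: the arbelos together with the two circles $(A_1)$ and $(A_2)$ passing through $M$, where $(A_i)$ has center $A_i$ and radius $A_iM=2R_i$. Twin-cousins: for $i=1,2$, the $i$-th twin-cousin is a circle (unique up to reflection in the line $O_1O_2$) that is externally tangent to $(O_i)$, internally tangent to the external circle $(O)$, and internally tangent to $(A_i)$ (here the twin-cousin lies inside $(O)$ and inside $(A_i)$). Its radius is $s_i$. *)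

theory Defs
  imports "HOL-Analysis.Analysis"
begin

text \<open>
  A circle of the Euclidean plane is given by its centre and its radius; as a point set it is
  \<^term>\<open>sphere c r\<close>, and \<^term>\<open>ball c r\<close> is its open interior.
  Two circles are tangent at \<^term>\<open>p\<close> when \<^term>\<open>p\<close> is their only common point.
\<close>

definition externally_tangent_at ::
  "real^2 \<Rightarrow> real \<Rightarrow> real^2 \<Rightarrow> real \<Rightarrow> real^2 \<Rightarrow> bool" where
  "externally_tangent_at c r d s p \<longleftrightarrow>
     0 < r \<and> 0 < s \<and> sphere c r \<inter> sphere d s = {p} \<and> ball c r \<inter> ball d s = {}"

text \<open>The first circle is the inner one.\<close>

definition internally_tangent_at ::
  "real^2 \<Rightarrow> real \<Rightarrow> real^2 \<Rightarrow> real \<Rightarrow> real^2 \<Rightarrow> bool" where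
  "internally_tangent_at c r d s p \<longleftrightarrow>
     0 < r \<and> 0 < s \<and> sphere c r \<inter> sphere d s = {p} \<and> ball c r \<subseteq> ball d s"

definition externally_tangent :: "real^2 \<Rightarrow> real \<Rightarrow> real^2 \<Rightarrow> real \<Rightarrow> bool" where
  "externally_tangent c r d s \<longleftrightarrow> (\<exists>p. externally_tangent_at c r d s p)"

definition internally_tangent :: "real^2 \<Rightarrow> real \<Rightarrow> real^2 \<Rightarrow> real \<Rightarrow> bool" where
  "internally_tangent c r d s \<longleftrightarrow> (\<exists>p. internally_tangent_at c r d s p)"

text \<open>
  The collinear order of \<open>A1, O1, M, O2, A2\<close> and the fact that the segment from \<open>A1\<close> to \<open>A2\<close>
  is a diameter of the external circle (centre \<open>Oc\<close>) follow from these conditions.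
\<close>

definition arbelos ::
  "real^2 \<Rightarrow> real \<Rightarrow> real^2 \<Rightarrow> real \<Rightarrow> real^2 \<Rightarrow> real^2 \<Rightarrow> real^2 \<Rightarrow> real^2 \<Rightarrow> bool" where
  "arbelos O1 R1 O2 R2 M Oc A1 A2 \<longleftrightarrow>
     0 < R1 \<and> 0 < R2 \<and>
     externally_tangent_at O1 R1 O2 R2 M \<and>
     Oc \<in> affine hull {O1, O2} \<and>
     internally_tangent_at O1 R1 Oc (R1 + R2) A1 \<and>
     internally_tangent_at O2 R2 Oc (R1 + R2) A2"

text \<open>
  Here \<open>(Oi, Ri)\<close> is one of the internal circles, \<open>(Oc, R)\<close> the external circle, and \<open>Ai\<close> the
  centre of the circle through \<open>M\<close> that the doubling arbelos adds on that side.
\<close>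

definition twin_cousin ::
  "real^2 \<Rightarrow> real \<Rightarrow> real^2 \<Rightarrow> real \<Rightarrow> real^2 \<Rightarrow> real^2 \<Rightarrow> real^2 \<Rightarrow> real \<Rightarrow> bool" where
  "twin_cousin Oi Ri Oc R Ai M C s \<longleftrightarrow>
     externally_tangent C s Oi Ri \<and>
     internally_tangent C s Oc R \<and>
     internally_tangent C s Ai (dist Ai M)"

end

theory Submission
  imports Defs
begin

text \<open>
  Tangency of circles is a statement about the distance of the centres: the sum of the radii for
  external tangency, their difference for internal tangency. In an arbelos these distances add up
  along triples of points, and equality in the triangle inequality then puts all points on one
  axis: with the unit vector \<open>e\<close> from \<open>O1\<close> towards \<open>O2\<close> and \<open>A1\<close> as origin, the points
  \<open>O1\<close>, \<open>M\<close>, \<open>Oc\<close> have the abscissas \<open>R1\<close>, \<open>2 * R1\<close>, \<open>R1 + R2\<close> (lemma \<open>arbelos_axis\<close>).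

  The centre of the first twin-cousin therefore has the known distances \<open>2 * R1 - s\<close>, \<open>R1 + s\<close> and
  \<open>R1 + R2 - s\<close> from three points of the axis. Subtracting the squared distances in pairs
  leaves two equations that are linear in the abscissa of the centre; eliminating it gives
  \<open>1 / s = 2 / R1 + 1 / R2\<close> (lemma \<open>twin_cousin_curvature\<close>). The arbelos is symmetric in
  its two inner circles, so the second twin-cousin satisfies the same formula with the radii
  exchanged, and the two curvatures sum to \<open>3 * (1 / R1 + 1 / R2)\<close>.
\<close>

text \<open>
  Disjointness of the discs bounds the distance of the centres from below, the triangle inequality
  through the common point bounds it from above.
\<close>

lemma externally_tangent_at_dist:
  assumes "externally_tangent_at c r d s p"
  shows "0 < r" "0 < s" "dist c p = r" "dist d p = s" "dist c d = r + s"
proof -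
  have p: "p \<in> sphere c r \<inter> sphere d s" and disj: "ball c r \<inter> ball d s = {}"
    and pos: "0 < r" "0 < s"
    using assms unfolding externally_tangent_at_def by auto
  show "0 < r" "0 < s" by (fact pos)+
  show cp: "dist c p = r" and dp: "dist d p = s" using p by auto
  have "r + s \<le> dist c d"
  proof (rule ccontr)
    assume "\<not> r + s \<le> dist c d"
    hence lt: "dist c d / (r + s) < 1" using pos by simp
    \<comment> \<open>The point that divides the segment of the centres in the ratio of the radii would lie in
      both discs.\<close>
    define q where "q = c + (r / (r + s)) *\<^sub>R (d - c)"
    have "dist c q = r * (dist c d / (r + s))"
      using pos by (simp add: q_def dist_norm norm_minus_commute)
    moreover have "d - q = (1 - r / (r + s)) *\<^sub>R (d - c)"
      by (simp add: q_def scaleR_left_diff_distrib)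
    hence "dist d q = \<bar>1 - r / (r + s)\<bar> * dist c d"
      by (simp add: dist_norm norm_minus_commute)
    moreover have "1 - r / (r + s) = s / (r + s)" using pos by (simp add: field_simps)
    ultimately have "q \<in> ball c r \<inter> ball d s"
      using pos mult_strict_left_mono[OF lt, of r] mult_strict_left_mono[OF lt, of s] by simp
    thus False using disj by blast
  qed
  moreover have "dist c d \<le> r + s"
    using dist_triangle2[of c d p] cp dp by simp
  ultimately show "dist c d = r + s" by simp
qed

lemma internally_tangent_at_dist:
  assumes "internally_tangent_at c r d s p"
  shows "dist c p = r" "dist d p = s" "dist c d = s - r"
proof -
  have p: "p \<in> sphere c r \<inter> sphere d s" and sub: "ball c r \<subseteq> ball d s" and pos: "0 < r"
    using assms unfolding internally_tangent_at_def by auto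
  show cp: "dist c p = r" and dp: "dist d p = s" using p by auto
  have "dist c d \<le> s - r"
    using sub pos by (auto simp: ball_subset_ball_iff)
  moreover have "s - r \<le> dist c d"
    using dist_triangle[of d p c] cp dp by (simp add: dist_commute)
  ultimately show "dist c d = s - r" by simp
qed

lemma arbelos_commute:
  "arbelos O1 R1 O2 R2 M Oc A1 A2 \<Longrightarrow> arbelos O2 R2 O1 R1 M Oc A2 A1"
  by (simp add: arbelos_def externally_tangent_at_def insert_commute Int_commute add.commute)

lemma point_between_of_dist_add:
  fixes x y z :: "'a::real_inner"
  assumes "dist x y = a" "dist y z = b" "dist x z = a + b"
  shows "a *\<^sub>R (y - z) = b *\<^sub>R (x - y)"
  using assms dist_triangle_eq[of x z y] by (simp add: dist_norm)

text \<open>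
  Each of \<open>M\<close>, \<open>Oc\<close>, \<open>A1\<close> is located by one degenerate triangle: \<open>M\<close> and \<open>Oc\<close> lie between \<open>O1\<close>
  and \<open>O2\<close>, and \<open>O1\<close> lies between \<open>A1\<close> and \<open>Oc\<close>.
\<close>

lemma arbelos_axis:
  assumes "arbelos O1 R1 O2 R2 M Oc A1 A2"
  obtains e where "norm e = 1" "O1 = A1 + R1 *\<^sub>R e" "M = A1 + (2 * R1) *\<^sub>R e"
    "Oc = A1 + (R1 + R2) *\<^sub>R e"
proof -
  have pos: "0 < R1" "0 < R2"
    and M: "externally_tangent_at O1 R1 O2 R2 M"
    and A1: "internally_tangent_at O1 R1 Oc (R1 + R2) A1"
    and A2: "internally_tangent_at O2 R2 Oc (R1 + R2) A2"
    using assms unfolding arbelos_def by auto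
  note dM = externally_tangent_at_dist[OF M]
  note dA1 = internally_tangent_at_dist[OF A1]
  note dA2 = internally_tangent_at_dist[OF A2]
  define R where "R = R1 + R2"
  define e where "e = (1 / R) *\<^sub>R (O2 - O1)"
  have R: "0 < R" using pos by (simp add: R_def)
  have O2: "O2 = O1 + R *\<^sub>R e" using R by (simp add: e_def)
  have e: "norm e = 1"
    using R dM(5) by (simp add: e_def R_def dist_norm norm_minus_commute)
  have on_axis: "P = O1 + a *\<^sub>R e"
    if "dist O1 P = a" "dist P O2 = b" "a + b = R" for P a b
  proof -
    have "a *\<^sub>R (P - O2) = b *\<^sub>R (O1 - P)"
      using that dM(5) by (intro point_between_of_dist_add) (auto simp: R_def)
    hence "(a + b) *\<^sub>R P = (a + b) *\<^sub>R O1 + a *\<^sub>R (O2 - O1)"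
      by (simp add: algebra_simps)
    hence "R *\<^sub>R P = R *\<^sub>R (O1 + a *\<^sub>R e)"
      using that(3) by (simp add: O2 algebra_simps)
    thus ?thesis using R by simp
  qed
  have M_eq: "M = O1 + R1 *\<^sub>R e"
    using dM by (intro on_axis[of M R1 R2]) (auto simp: dist_commute R_def)
  have Oc_eq: "Oc = O1 + R2 *\<^sub>R e"
    using dA1 dA2 by (intro on_axis[of Oc R2 R1]) (auto simp: dist_commute R_def)
  have "R1 *\<^sub>R (O1 - Oc) = R2 *\<^sub>R (A1 - O1)"
    using dA1 by (intro point_between_of_dist_add) (auto simp: dist_commute)
  hence "R2 *\<^sub>R O1 = R2 *\<^sub>R (A1 + R1 *\<^sub>R e)"
    by (simp add: Oc_eq algebra_simps)
  hence O1_eq: "O1 = A1 + R1 *\<^sub>R e" using pos by simp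
  show thesis
  proof
    show "M = A1 + (2 * R1) *\<^sub>R e"
      unfolding M_eq O1_eq mult_2 scaleR_add_left by (rule add.assoc)
    show "Oc = A1 + (R1 + R2) *\<^sub>R e"
      by (simp add: Oc_eq O1_eq flip: scaleR_add_left)
  qed (fact e O1_eq)+
qed

lemma dist_point_on_axis_squared:
  fixes A C e :: "'a::real_inner"
  assumes "norm e = 1"
  shows "(dist C (A + t *\<^sub>R e))\<^sup>2 = (dist C A)\<^sup>2 - 2 * t * ((C - A) \<bullet> e) + t\<^sup>2"
proof -
  have "e \<bullet> e = 1" using assms by (simp add: dot_square_norm)
  thus ?thesis
    unfolding dist_norm power2_norm_eq_inner
    by (simp add: inner_diff_left inner_diff_right inner_add_left inner_add_right
        inner_commute algebra_simps power2_eq_square)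
qed

lemma twin_cousin_curvature:
  assumes "arbelos O1 R1 O2 R2 M Oc A1 A2"
    and "twin_cousin O1 R1 Oc (R1 + R2) A1 M C s"
  shows "1 / s = 2 / R1 + 1 / R2"
proof -
  have R1: "0 < R1" and R2: "0 < R2"
    using assms(1) by (auto simp: arbelos_def)
  obtain e where e: "norm e = 1" and O1: "O1 = A1 + R1 *\<^sub>R e"
    and M: "M = A1 + (2 * R1) *\<^sub>R e" and Oc: "Oc = A1 + (R1 + R2) *\<^sub>R e"
    using arbelos_axis[OF assms(1)] .
  have A1M: "dist A1 M = 2 * R1"
    using e R1 by (simp add: M dist_norm)
  have s: "0 < s" and dO1: "dist C O1 = s + R1" and dOc: "dist C Oc = R1 + R2 - s"
    and dA1: "dist C A1 = 2 * R1 - s"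
    using assms(2) A1M
    by (auto simp: twin_cousin_def externally_tangent_def internally_tangent_def
        dest: externally_tangent_at_dist internally_tangent_at_dist)
  define x where "x = (C - A1) \<bullet> e"
  have "(s + R1)\<^sup>2 = (2 * R1 - s)\<^sup>2 - 2 * R1 * x + R1\<^sup>2"
    using dist_point_on_axis_squared[OF e, of C A1 R1] dO1 dA1 by (simp add: O1 x_def)
  hence "2 * R1 * x = 2 * R1 * (2 * R1 - 3 * s)"
    by (simp add: power2_eq_square algebra_simps)
  hence x: "x = 2 * R1 - 3 * s" using R1 by simp
  have "(R1 + R2 - s)\<^sup>2 = (2 * R1 - s)\<^sup>2 - 2 * (R1 + R2) * x + (R1 + R2)\<^sup>2"
    using dist_point_on_axis_squared[OF e, of C A1 "R1 + R2"] dOc dA1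
    by (simp add: Oc x_def)
  hence "s * (R1 + 2 * R2) = R1 * R2"
    unfolding x by (simp add: power2_eq_square algebra_simps)
  thus ?thesis using s R1 R2 by (simp add: field_simps)
qed

theorem theorem5:
  fixes O1 O2 M Oc A1 A2 C1 C2 :: "real^2"
    and R1 R2 s1 s2 :: real
  assumes "arbelos O1 R1 O2 R2 M Oc A1 A2"
    and "twin_cousin O1 R1 Oc (R1 + R2) A1 M C1 s1"
    and "twin_cousin O2 R2 Oc (R1 + R2) A2 M C2 s2"
  shows "1 / s1 + 1 / s2 = 3 * (1 / R1 + 1 / R2)"
proof -
  have "1 / s1 = 2 / R1 + 1 / R2"
    using assms(1,2) by (rule twin_cousin_curvature)
  moreover have "1 / s2 = 2 / R2 + 1 / R1"
    using twin_cousin_curvature[OF arbelos_commute[OF assms(1)]] assms(3)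
    by (simp add: add.commute)
  ultimately show ?thesis by (simp add: algebra_simps)
qed

end
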